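(* Let $x_1,x_2,a,\lambda\in\mathbb{C}$ with $\operatorname{Re}(a+\lambda)>0$. Assume that $x_1,x_2,\lambda$ are not non-positive integers and that, for every integer $k\ge 0$, the number $\lambda-\frac{(\lambda-x_1)(\lambda-x_2)}{\lambda+k}$ is not a non-positive integer. Then $$\frac{\Gamma(x_1)\Gamma(x_2)}{\Gamma(x_1+x_2+a)}=\sum_{k=0}^\infty\frac{(-1)^k}{k!}\cdot\frac{\Gamma\left(\lambda-\frac{(\lambda-x_1)(\lambda-x_2)}{\lambda+k}\right)}{\Gamma\left(\lambda-\frac{(\lambda-x_1)(\lambda-x_2)}{\lambda+k}+a-k\right)}\left(\frac{1}{x_1+k}+\frac{1}{x_2+k}-\frac{1}{\lambda+k}\right).$$
   Context: The reciprocal gamma function $1/\Gamma$ is understood as an entire function (equal to $0$ at the non-positive integers). *)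

theory Defs
  imports "HOL-Analysis.Analysis"
begin

end

theory Submission
  imports Defs
begin

text \<open>
  Put \<open>p = (l - x\<^sub>1) (l - x\<^sub>2)\<close> and move \<open>(z\<^sub>1, z\<^sub>2)\<close> along the curve
  \<open>(l - z\<^sub>1) (l - z\<^sub>2) = p\<close>, which passes through \<open>(x\<^sub>1, x\<^sub>2)\<close>. With \<open>s = l - z\<^sub>1\<close> the quotient
  \<open>\<Gamma>(z\<^sub>1) \<Gamma>(z\<^sub>2) / \<Gamma>(z\<^sub>1 + z\<^sub>2 + a)\<close> is a function on this curve that is invariant under the
  exchange \<open>s \<mapsto> p / s\<close> of \<open>z\<^sub>1\<close> and \<open>z\<^sub>2\<close>, hence a function of \<open>t = s + p / s = 2 l - z\<^sub>1 - z\<^sub>2\<close>.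
  Its poles are the values \<open>t\<^sub>k = l + k + p / (l + k)\<close>; there one argument is \<open>- k\<close> and the other
  one is \<open>w\<^sub>k = l - p / (l + k)\<close>. The series is the expansion into partial fractions in \<open>t\<close>.

  No contour integral is needed to justify it. Truncating Gauss's product for each Gamma function
  after \<open>n\<close> makes the quotient a product of \<open>n + 1\<close> fractions, each linear over linear in \<open>t\<close>,
  and the partial fraction expansion becomes a finite identity
  (\<open>pochhammer_beta_expansion\<close>, \<open>Gamma_series_beta_expansion\<close>). The hypotheses on \<open>w\<^sub>k\<close> make the
  poles distinct, because \<open>(l + j) (t\<^sub>j - t\<^sub>k) = (j - k) (w\<^sub>k + j)\<close>. The truncated quotient also
  has a value at \<open>t = \<infinity>\<close>, namely the truncated \<open>\<Gamma>(l)\<close> times \<open>n\<close> to the power \<open>- (a + l)\<close>; it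
  disappears in the limit because \<open>Re (a + l) > 0\<close>.

  Each term of the finite identity tends to the corresponding term of the series, so it remains
  to dominate the terms uniformly in \<open>n\<close> and to apply Tannery's theorem. The bound is of order
  \<open>k\<close> to the power \<open>- 1 - \<delta>\<close> for any positive \<open>\<delta> < Re (a + l)\<close>. Here \<open>- 1\<close> is due to the
  bracket of three fractions, and \<open>- \<delta>\<close> to the Gamma factors
  (\<open>norm_choose_Gamma_series_rGamma_series_le\<close>), whose size is found by comparing products
  \<open>\<Prod>j=1..m. 1 + z / j\<close> with \<open>exp (z * harm m)\<close>, uniformly for bounded \<open>z\<close>.
\<close>

section \<open>Partial fractions of a truncated Beta quotient\<close>

text \<open>
  By induction: multiplying by one more factor \<open>1 + (b i - t i) / (t i - x)\<close> changes the residue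
  at each old pole by the value of this factor there, and the residue at the new pole \<open>t i\<close> is
  governed by the induction hypothesis evaluated at \<open>x = t i\<close>. This is why the point \<open>x\<close> has to
  stay arbitrary.
\<close>

lemma prod_ratio_partial_fractions:
  fixes b t :: "'i \<Rightarrow> 'a::field"
  assumes "finite S" "inj_on t S" "x \<notin> t ` S"
  shows "(\<Prod>j\<in>S. (b j - x) / (t j - x)) =
           1 + (\<Sum>k\<in>S. (b k - t k) * (\<Prod>j\<in>S - {k}. (b j - t k) / (t j - t k)) / (t k - x))"
  using assms
proof (induction S arbitrary: x rule: finite_induct)
  case empty
  then show ?case by simp
next
  case (insert i S)
  define A where "A k = (b k - t k) * (\<Prod>j\<in>S - {k}. (b j - t k) / (t j - t k))" for k
  have inj: "inj_on t S" and ti: "t i \<notin> t ` S" and x: "x \<notin> t ` S" "t i - x \<noteq> 0"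
    using insert by auto
  have IHx: "(\<Prod>j\<in>S. (b j - x) / (t j - x)) = 1 + (\<Sum>k\<in>S. A k / (t k - x))"
    and IHi: "(\<Prod>j\<in>S. (b j - t i) / (t j - t i)) = 1 + (\<Sum>k\<in>S. A k / (t k - t i))"
    unfolding A_def using insert.IH inj ti x by blast+
  have old: "(b k - t k) * (\<Prod>j\<in>insert i S - {k}. (b j - t k) / (t j - t k)) / (t k - x) =
      A k * ((b i - t k) / (t i - t k)) / (t k - x)" if "k \<in> S" for k
  proof -
    have "insert i S - {k} = insert i (S - {k})" using that insert by auto
    then show ?thesis using insert by (simp add: A_def mult_ac)
  qed
  have new: "insert i S - {i} = S" using insert by auto
  have split: "A k * ((b i - t k) / (t i - t k)) / (t k - x) =
      (b i - x) / (t i - x) * (A k / (t k - x)) - (b i - t i) / (t i - x) * (A k / (t k - t i))"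
    if "k \<in> S" for k
  proof -
    have nz: "t i - t k \<noteq> 0" "t k - t i \<noteq> 0" "t k - x \<noteq> 0" using that ti x by (auto simp: image_iff)
    have "A k / (t k - t i) = - (A k / (t i - t k))"
      by (metis minus_diff_eq divide_minus_right)
    then have "(b i - x) / (t i - x) * (A k / (t k - x)) - (b i - t i) / (t i - x) * (A k / (t k - t i))
      = A k * ((b i - x) / ((t i - x) * (t k - x)) + (b i - t i) / ((t i - x) * (t i - t k)))"
      by (simp add: distrib_left mult.commute[of "A k"])
    also have "(b i - x) / ((t i - x) * (t k - x)) + (b i - t i) / ((t i - x) * (t i - t k))
      = ((b i - x) * (t i - t k) + (b i - t i) * (t k - x)) / ((t i - x) * (t k - x) * (t i - t k))"
      using nz x by (simp add: add_divide_distrib)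
    also have "(b i - x) * (t i - t k) + (b i - t i) * (t k - x) = (b i - t k) * (t i - x)"
      by (simp add: algebra_simps)
    finally show ?thesis using nz x by simp
  qed
  have sum_split: "(\<Sum>k\<in>S. A k * ((b i - t k) / (t i - t k)) / (t k - x)) =
      (b i - x) / (t i - x) * (\<Sum>k\<in>S. A k / (t k - x)) -
      (b i - t i) / (t i - x) * (\<Sum>k\<in>S. A k / (t k - t i))"
    by (simp only: split sum_subtractf sum_distrib_left cong: sum.cong)
  have "(\<Sum>k\<in>insert i S. (b k - t k) * (\<Prod>j\<in>insert i S - {k}. (b j - t k) / (t j - t k)) / (t k - x))
     = (b i - t i) * (\<Prod>j\<in>S. (b j - t i) / (t j - t i)) / (t i - x) +
       (\<Sum>k\<in>S. A k * ((b i - t k) / (t i - t k)) / (t k - x))"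
    using insert old by (simp add: new)
  also have "\<dots> = (b i - t i) / (t i - x) + (b i - x) / (t i - x) * (\<Sum>k\<in>S. A k / (t k - x))"
    by (simp only: IHi sum_split) (simp add: distrib_left add_divide_distrib)
  also have "1 + \<dots> = (b i - x) / (t i - x) * (1 + (\<Sum>k\<in>S. A k / (t k - x)))"
  proof -
    have "1 + (b i - t i) / (t i - x) = (b i - x) / (t i - x)"
      using x by (simp add: field_simps)
    then show ?thesis by (simp only: distrib_left mult_1_right flip: add.assoc)
  qed
  also have "\<dots> = (\<Prod>j\<in>insert i S. (b j - x) / (t j - x))"
    using insert by (simp add: IHx)
  finally show ?case by simp
qed

text \<open>
  The denominators in Gauss's product for \<open>\<Gamma>(z)\<close>, without the vanishing one, at the pole \<open>z = - k\<close>.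
\<close>

lemma prod_differences_omitting:
  assumes "k \<le> n"
  shows "(\<Prod>j\<in>{..n} - {k}. of_nat j - of_nat k :: 'a::field_char_0) = (-1) ^ k * fact k * fact (n - k)"
proof -
  have low: "(\<Prod>j<k. of_nat j - of_nat k :: 'a) = (-1) ^ k * fact k"
  proof -
    have "(\<Prod>j<k. of_nat j - of_nat k :: 'a) = (\<Prod>j<k. (-1) * of_nat (Suc j))"
      by (rule prod.reindex_bij_witness[of _ "\<lambda>j. k - 1 - j" "\<lambda>j. k - 1 - j"]) (auto simp: of_nat_diff)
    also have "\<dots> = (-1) ^ k * fact k"
      by (subst prod.distrib) (simp add: fact_prod_Suc lessThan_atLeast0)
    finally show ?thesis .
  qed
  have high: "(\<Prod>j\<in>{k<..n}. of_nat j - of_nat k :: 'a) = fact (n - k)"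
  proof -
    have "(\<Prod>j\<in>{k<..n}. of_nat j - of_nat k :: 'a) = (\<Prod>j\<in>{1..n-k}. of_nat j)"
      using assms
      by (intro prod.reindex_bij_witness[of _ "\<lambda>j. j + k" "\<lambda>j. j - k"]) (auto simp: of_nat_diff)
    then show ?thesis by (simp add: fact_prod)
  qed
  have "{..n} - {k} = {..<k} \<union> {k<..n}" using assms by auto
  moreover have "{..<k} \<inter> {k<..n} = {}" by auto
  ultimately show ?thesis by (simp add: prod.union_disjoint low high)
qed

text \<open>
  The partial fraction expansion in \<open>t\<close>, with zeros \<open>b j\<close> and poles \<open>t j\<close>, evaluated at the
  value \<open>x\<close> of \<open>t\<close> that belongs to \<open>(x\<^sub>1, x\<^sub>2)\<close>. Every difference that occurs in it factors in the
  original parameters. The bracket in the summand is the fraction \<open>1 / (t k - x)\<close> up to the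
  factor \<open>(w k + k) / (l + k)\<close>; the extra \<open>w k + k\<close> completes \<open>pochhammer (w k) (Suc n)\<close>, whose
  \<open>k\<close>-th factor is absent from the residue.
\<close>

lemma pochhammer_beta_expansion:
  fixes x\<^sub>1 x\<^sub>2 a l :: "'a::field_char_0"
  defines "w \<equiv> \<lambda>k::nat. l - (l - x\<^sub>1) * (l - x\<^sub>2) / (l + of_nat k)"
  assumes nz: "\<And>j. x\<^sub>1 + of_nat j \<noteq> 0" "\<And>j. x\<^sub>2 + of_nat j \<noteq> 0" "\<And>j. l + of_nat j \<noteq> 0"
    and w: "\<And>k j. w k + of_nat j \<noteq> 0"
  shows "pochhammer (x\<^sub>1 + x\<^sub>2 + a) (Suc n) / (pochhammer x\<^sub>1 (Suc n) * pochhammer x\<^sub>2 (Suc n)) =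
           1 / pochhammer l (Suc n) +
           (\<Sum>k\<le>n. (-1) ^ k / (fact k * fact (n - k)) *
              (pochhammer (w k + a - of_nat k) (Suc n) / pochhammer (w k) (Suc n)) *
              (1 / (x\<^sub>1 + of_nat k) + 1 / (x\<^sub>2 + of_nat k) - 1 / (l + of_nat k)))"
proof -
  define p where "p = (l - x\<^sub>1) * (l - x\<^sub>2)"
  define b where "b j = 2 * l + a + of_nat j" for j :: nat
  define t where "t j = l + of_nat j + p / (l + of_nat j)" for j :: nat
  define x where "x = 2 * l - x\<^sub>1 - x\<^sub>2"
  have poch: "(\<Prod>j\<le>n. c + of_nat j) = pochhammer c (Suc n)" for c :: 'a
    by (simp add: pochhammer_Suc_prod atMost_atLeast0)
  have tx: "t j - x = (x\<^sub>1 + of_nat j) * (x\<^sub>2 + of_nat j) / (l + of_nat j)" for j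
    using nz(3)[of j] unfolding t_def x_def p_def by (simp add: field_simps)
  have tt: "t j - t k = (of_nat j - of_nat k) * (w k + of_nat j) / (l + of_nat j)" for j k
    using nz(3)[of j] nz(3)[of k] unfolding t_def w_def p_def[symmetric] by (simp add: field_simps)
  have bt: "b j - t k = w k + a - of_nat k + of_nat j" for j k
    unfolding t_def w_def p_def[symmetric] b_def by simp
  have bx: "b j - x = x\<^sub>1 + x\<^sub>2 + a + of_nat j" for j
    unfolding b_def x_def by simp
  have weight: "1 / (x\<^sub>1 + of_nat k) + 1 / (x\<^sub>2 + of_nat k) - 1 / (l + of_nat k) =
      (w k + of_nat k) / ((x\<^sub>1 + of_nat k) * (x\<^sub>2 + of_nat k))" for k
    using nz(1)[of k] nz(2)[of k] nz(3)[of k] unfolding w_def by (simp add: divide_simps) algebra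
  have pl: "pochhammer l (Suc n) \<noteq> 0"
    using nz(3) by (metis add.commute neg_eq_iff_add_eq_0 pochhammer_eq_0_iff)
  have "inj_on t {..n}"
  proof (rule inj_onI)
    fix j k assume "t j = t k"
    then have "(of_nat j - of_nat k) * (w k + of_nat j) = 0"
      using tt[of j k] nz(3)[of j] by simp
    then show "j = k" using w[of k j] by simp
  qed
  moreover have "x \<notin> t ` {..n}"
    using tx nz by (metis (no_types, lifting) divide_eq_0_iff imageE mult_eq_0_iff right_minus_eq)
  ultimately have "(\<Prod>j\<le>n. (b j - x) / (t j - x)) =
      1 + (\<Sum>k\<le>n. (b k - t k) * (\<Prod>j\<in>{..n} - {k}. (b j - t k) / (t j - t k)) / (t k - x))"
    by (intro prod_ratio_partial_fractions) auto
  also have "(\<Prod>j\<le>n. (b j - x) / (t j - x)) = pochhammer l (Suc n) *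
      (pochhammer (x\<^sub>1 + x\<^sub>2 + a) (Suc n) / (pochhammer x\<^sub>1 (Suc n) * pochhammer x\<^sub>2 (Suc n)))"
    by (simp add: bx tx prod_dividef prod.distrib poch)
  also have "(\<Sum>k\<le>n. (b k - t k) * (\<Prod>j\<in>{..n} - {k}. (b j - t k) / (t j - t k)) / (t k - x)) =
     (\<Sum>k\<le>n. pochhammer l (Suc n) * ((-1) ^ k / (fact k * fact (n - k)) *
              (pochhammer (w k + a - of_nat k) (Suc n) / pochhammer (w k) (Suc n)) *
              (1 / (x\<^sub>1 + of_nat k) + 1 / (x\<^sub>2 + of_nat k) - 1 / (l + of_nat k))))"
  proof (rule sum.cong)
    fix k assume "k \<in> {..n}"
    then have k: "k \<le> n" by simp
    have omit: "(\<Prod>j\<in>{..n} - {k}. f j) = (\<Prod>j\<le>n. f j) / f k" if "f k \<noteq> 0" for f :: "nat \<Rightarrow> 'a"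
      using that k by (simp add: prod.remove[of "{..n}" k])
    have num: "(b k - t k) * (\<Prod>j\<in>{..n} - {k}. b j - t k) = pochhammer (w k + a - of_nat k) (Suc n)"
      using k by (subst poch[symmetric], subst bt[symmetric], subst (2) prod.remove[of _ k]) (auto simp: bt)
    have den: "(\<Prod>j\<in>{..n} - {k}. t j - t k) = (-1) ^ k * fact k * fact (n - k) *
        (pochhammer (w k) (Suc n) / (w k + of_nat k)) / (pochhammer l (Suc n) / (l + of_nat k))"
      by (simp only: tt prod_dividef prod.distrib prod_differences_omitting[OF k]
          omit[of "\<lambda>j. w k + of_nat j", OF w] omit[of "\<lambda>j. l + of_nat j", OF nz(3)] poch)
    have "(b k - t k) * (\<Prod>j\<in>{..n} - {k}. (b j - t k) / (t j - t k)) / (t k - x) =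
      ((b k - t k) * (\<Prod>j\<in>{..n} - {k}. b j - t k)) / (\<Prod>j\<in>{..n} - {k}. t j - t k) / (t k - x)"
      by (simp add: prod_dividef)
    also have "\<dots> = pochhammer l (Suc n) * ((-1) ^ k / (fact k * fact (n - k)) *
              (pochhammer (w k + a - of_nat k) (Suc n) / pochhammer (w k) (Suc n)) *
              (1 / (x\<^sub>1 + of_nat k) + 1 / (x\<^sub>2 + of_nat k) - 1 / (l + of_nat k)))"
      unfolding num den tx weight using nz(3)[of k] pl
      by (simp add: divide_simps)
    finally show "(b k - t k) * (\<Prod>j\<in>{..n} - {k}. (b j - t k) / (t j - t k)) / (t k - x) =
      pochhammer l (Suc n) * ((-1) ^ k / (fact k * fact (n - k)) *
              (pochhammer (w k + a - of_nat k) (Suc n) / pochhammer (w k) (Suc n)) *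
              (1 / (x\<^sub>1 + of_nat k) + 1 / (x\<^sub>2 + of_nat k) - 1 / (l + of_nat k)))" .
  qed simp
  also have "1 + \<dots> = pochhammer l (Suc n) * (1 / pochhammer l (Suc n) +
           (\<Sum>k\<le>n. (-1) ^ k / (fact k * fact (n - k)) *
              (pochhammer (w k + a - of_nat k) (Suc n) / pochhammer (w k) (Suc n)) *
              (1 / (x\<^sub>1 + of_nat k) + 1 / (x\<^sub>2 + of_nat k) - 1 / (l + of_nat k))))"
    using pl by (simp only: distrib_left sum_distrib_left) simp
  finally show ?thesis
    unfolding mult_left_cancel[OF pl] .
qed

section \<open>Passage to truncated Gamma products\<close>

lemma Gamma_series_mult_rGamma_series:
  "Gamma_series c n * rGamma_series d n =
     exp ((c - d) * of_real (ln (of_nat n))) * (pochhammer d (Suc n) / pochhammer c (Suc n))"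
  for c d :: complex
  by (simp add: Gamma_series_def rGamma_series_def left_diff_distrib exp_diff)

text \<open>
  This is \<open>pochhammer_beta_expansion\<close> multiplied by \<open>fact n\<close> and by \<open>n\<close> to the power \<open>- a\<close>.
  The power distributes differently over the two sides: in the summand a factor \<open>n ^ k\<close> is left
  over, because the arguments of the two Gamma factors differ by \<open>a - k\<close>. It is compensated by
  the binomial coefficient, whose quotient by \<open>n ^ k\<close> tends to \<open>1 / fact k\<close>. The binomial
  coefficient also makes the summand vanish for \<open>k > n\<close>, so that the sum may be read as a series.
\<close>

lemma Gamma_series_beta_expansion:
  fixes x\<^sub>1 x\<^sub>2 a l :: complex
  defines "w \<equiv> \<lambda>k::nat. l - (l - x\<^sub>1) * (l - x\<^sub>2) / (l + of_nat k)"
  assumes nz: "\<And>j. x\<^sub>1 + of_nat j \<noteq> 0" "\<And>j. x\<^sub>2 + of_nat j \<noteq> 0" "\<And>j. l + of_nat j \<noteq> 0"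
    and w: "\<And>k j. w k + of_nat j \<noteq> 0"
    and n: "0 < n"
  shows "Gamma_series x\<^sub>1 n * Gamma_series x\<^sub>2 n * rGamma_series (x\<^sub>1 + x\<^sub>2 + a) n =
           Gamma_series l n * exp (- (a + l) * of_real (ln (of_nat n))) +
           (\<Sum>k\<le>n. (-1) ^ k * (of_nat (n choose k) / of_nat n ^ k) *
              (Gamma_series (w k) n * rGamma_series (w k + a - of_nat k) n) *
              (1 / (x\<^sub>1 + of_nat k) + 1 / (x\<^sub>2 + of_nat k) - 1 / (l + of_nat k)))"
proof -
  define E where "E c = exp (c * complex_of_real (ln (of_nat n)))" for c
  have E_add: "E (c + d) = E c * E d" for c d
    by (simp add: E_def distrib_right exp_add)
  have E_nat: "E (of_nat k) = of_nat n ^ k" for k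
    using n by (simp add: E_def exp_of_nat_mult exp_of_real)
  have "Gamma_series x\<^sub>1 n * Gamma_series x\<^sub>2 n * rGamma_series (x\<^sub>1 + x\<^sub>2 + a) n =
     fact n * E (- a) *
       (pochhammer (x\<^sub>1 + x\<^sub>2 + a) (Suc n) / (pochhammer x\<^sub>1 (Suc n) * pochhammer x\<^sub>2 (Suc n)))"
    unfolding mult.assoc Gamma_series_mult_rGamma_series E_def[symmetric]
    using E_add[of x\<^sub>1 "- x\<^sub>1 - a"]
    by (simp add: Gamma_series_def E_def[symmetric])
  also have "\<dots> = fact n * E (- a) * (1 / pochhammer l (Suc n)) +
     (\<Sum>k\<le>n. fact n * E (- a) * ((-1) ^ k / (fact k * fact (n - k)) *
              (pochhammer (w k + a - of_nat k) (Suc n) / pochhammer (w k) (Suc n)) *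
              (1 / (x\<^sub>1 + of_nat k) + 1 / (x\<^sub>2 + of_nat k) - 1 / (l + of_nat k))))"
    unfolding pochhammer_beta_expansion[of x\<^sub>1 x\<^sub>2 l a n, OF nz w[unfolded w_def]]
    by (simp only: distrib_left sum_distrib_left w_def)
  also have "fact n * E (- a) * (1 / pochhammer l (Suc n)) = Gamma_series l n * E (- (a + l))"
    using E_add[of l "- (a + l)"] by (simp add: Gamma_series_def E_def[symmetric])
  also have "(\<Sum>k\<le>n. fact n * E (- a) * ((-1) ^ k / (fact k * fact (n - k)) *
              (pochhammer (w k + a - of_nat k) (Suc n) / pochhammer (w k) (Suc n)) *
              (1 / (x\<^sub>1 + of_nat k) + 1 / (x\<^sub>2 + of_nat k) - 1 / (l + of_nat k)))) =
     (\<Sum>k\<le>n. (-1) ^ k * (of_nat (n choose k) / of_nat n ^ k) *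
              (Gamma_series (w k) n * rGamma_series (w k + a - of_nat k) n) *
              (1 / (x\<^sub>1 + of_nat k) + 1 / (x\<^sub>2 + of_nat k) - 1 / (l + of_nat k)))"
  proof (rule sum.cong)
    fix k assume "k \<in> {..n}"
    then have "of_nat (n choose k) = (fact n / (fact k * fact (n - k)) :: complex)"
      by (simp add: binomial_fact)
    moreover have "E (w k - (w k + a - of_nat k)) = of_nat n ^ k * E (- a)"
      using E_add[of "of_nat k" "- a"] by (simp add: E_nat)
    ultimately show "fact n * E (- a) * ((-1) ^ k / (fact k * fact (n - k)) *
              (pochhammer (w k + a - of_nat k) (Suc n) / pochhammer (w k) (Suc n)) *
              (1 / (x\<^sub>1 + of_nat k) + 1 / (x\<^sub>2 + of_nat k) - 1 / (l + of_nat k))) =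
        (-1) ^ k * (of_nat (n choose k) / of_nat n ^ k) *
              (Gamma_series (w k) n * rGamma_series (w k + a - of_nat k) n) *
              (1 / (x\<^sub>1 + of_nat k) + 1 / (x\<^sub>2 + of_nat k) - 1 / (l + of_nat k))"
      using n by (simp only: Gamma_series_mult_rGamma_series E_def[symmetric]) simp
  qed simp
  finally show ?thesis by (simp only: E_def)
qed

section \<open>Exponential bounds for products of linear factors\<close>

lemma norm_one_plus_le_exp: "norm (1 + z) \<le> exp (Re z + (norm z)\<^sup>2 / 2)" for z :: complex
proof -
  have "(norm (1 + z))\<^sup>2 = 1 + (2 * Re z + (norm z)\<^sup>2)"
    unfolding cmod_power2 by (simp add: power2_eq_square algebra_simps)
  also have "\<dots> \<le> exp (2 * Re z + (norm z)\<^sup>2)"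
    by (rule exp_ge_add_one_self)
  also have "\<dots> = (exp (Re z + (norm z)\<^sup>2 / 2))\<^sup>2"
    by (simp flip: exp_double add: distrib_left)
  finally show ?thesis
    by (rule power2_le_imp_le) simp
qed

text \<open>
  For small \<open>z\<close> this follows from the upper bound for \<open>1 - z\<close> because
  \<open>(1 + z) (1 - z) = 1 - z\<^sup>2\<close> is close to \<open>1\<close>. For \<open>z\<close> away from \<open>0\<close> the quadratic term
  outweighs \<open>Re z\<close> and \<open>ln (1 / d)\<close> together, and its coefficient is chosen for that purpose.
\<close>

lemma inverse_norm_one_plus_le_exp:
  fixes z :: complex
  assumes "0 < d" "d \<le> norm (1 + z)"
  shows "inverse (norm (1 + z)) \<le> exp (- Re z + (3 + 4 / d) * (norm z)\<^sup>2)"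
proof (cases "norm z \<le> 1 / 2")
  case True
  define y where "y = (norm z)\<^sup>2"
  have y: "0 \<le> y" "y \<le> 1 / 2"
    using power_mono[OF True, of 2] by (auto simp: y_def power2_eq_square)
  have nz: "1 + z \<noteq> 0" using assms by auto
  have "1 - y \<le> norm (1 - z\<^sup>2)"
    unfolding y_def by (metis norm_one norm_power norm_triangle_ineq2)
  moreover have "1 \<le> (1 - y) * (1 + 2 * y)"
    using mult_nonneg_nonneg[of y "1 - 2 * y"] y by (simp add: algebra_simps)
  ultimately have "1 \<le> norm (1 - z\<^sup>2) * (1 + 2 * y)"
    using y by (smt (verit) mult_right_mono)
  also have "\<dots> \<le> norm (1 - z\<^sup>2) * exp (2 * y)"
    by (intro mult_left_mono exp_ge_add_one_self) simp
  also have "\<dots> = norm (1 + z) * norm (1 - z) * exp (2 * y)"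
    by (simp flip: norm_mult add: algebra_simps power2_eq_square)
  finally have "inverse (norm (1 + z)) \<le> norm (1 - z) * exp (2 * y)"
    using nz by (simp add: field_simps)
  also have "\<dots> \<le> exp (- Re z + y / 2) * exp (2 * y)"
    using norm_one_plus_le_exp[of "- z"] by (intro mult_right_mono) (auto simp: y_def)
  also have "\<dots> = exp (- Re z + (5 / 2) * y)"
    by (simp flip: exp_add)
  also have "\<dots> \<le> exp (- Re z + (3 + 4 / d) * y)"
    using y assms(1) by (intro exp_le_cancel_iff[THEN iffD2] add_left_mono mult_right_mono) auto
  finally show ?thesis by (simp add: y_def)
next
  case False
  define M where "M = 3 + 4 / d"
  have M: "M \<ge> 3" using assms by (simp add: M_def)
  have "inverse (norm (1 + z)) \<le> 1 / d"
    using assms by (simp add: divide_inverse le_imp_inverse_le)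
  also have "1 / d \<le> 1 + (1 / 2) * (M * (1 / 2) - 1)"
    using assms(1) by (simp add: M_def add_divide_distrib diff_divide_distrib)
  also have "\<dots> \<le> 1 + norm z * (M * norm z - 1)"
    using False M mult_left_mono[of "1/2" "norm z" M] by (intro add_left_mono mult_mono) auto
  also have "\<dots> \<le> exp (norm z * (M * norm z - 1))"
    by (rule exp_ge_add_one_self)
  also have "\<dots> \<le> exp (- Re z + M * (norm z)\<^sup>2)"
    using complex_Re_le_cmod[of z] by (simp add: power2_eq_square algebra_simps)
  finally show ?thesis by (simp add: M_def)
qed

text \<open>
  The second order errors in the factors sum up to a constant that does not depend on \<open>m\<close>.
\<close>

lemma prod_le_exp_harm:
  fixes f :: "nat \<Rightarrow> real"
  assumes "\<And>j. j \<in> {1..m} \<Longrightarrow> 0 \<le> f j"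
    and "\<And>j. j \<in> {1..m} \<Longrightarrow> f j \<le> exp (c / of_nat j + M / (of_nat j)\<^sup>2)"
    and "0 \<le> M"
  shows "(\<Prod>j=1..m. f j) \<le> exp (c * harm m + M * (pi\<^sup>2 / 6))"
proof -
  have "(\<Sum>j=1..m. 1 / (real j)\<^sup>2) = (\<Sum>j<m. 1 / (real j + 1)\<^sup>2)"
    by (rule sum.reindex_bij_witness[of _ Suc "\<lambda>j. j - 1"]) auto
  also have "\<dots> \<le> (\<Sum>j. 1 / (real j + 1)\<^sup>2)"
    using inverse_squares_sums by (intro sum_le_suminf) (auto simp: sums_iff add_ac)
  also have "\<dots> = pi\<^sup>2 / 6"
    using inverse_squares_sums by (simp add: sums_iff add_ac)
  finally have squares: "M * (\<Sum>j=1..m. 1 / (real j)\<^sup>2) \<le> M * (pi\<^sup>2 / 6)"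
    using assms(3) by (rule mult_left_mono)
  have "(\<Prod>j=1..m. f j) \<le> (\<Prod>j=1..m. exp (c / of_nat j + M / (of_nat j)\<^sup>2))"
    using assms by (intro prod_mono) auto
  also have "\<dots> = exp (c * harm m + M * (\<Sum>j=1..m. 1 / (real j)\<^sup>2))"
    by (simp add: exp_sum[symmetric] sum.distrib sum_distrib_left harm_def divide_inverse)
  also have "\<dots> \<le> exp (c * harm m + M * (pi\<^sup>2 / 6))"
    using squares by simp
  finally show ?thesis .
qed

lemma norm_prod_one_plus_le:
  fixes z :: complex
  assumes "norm z \<le> R"
  shows "norm (\<Prod>j=1..m. 1 + z / of_nat j) \<le> exp (Re z * harm m + R\<^sup>2 / 2 * (pi\<^sup>2 / 6))"
  unfolding prod_norm[symmetric]
proof (rule prod_le_exp_harm)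
  fix j assume "j \<in> {1..m}"
  have "norm (1 + z / of_nat j) \<le> exp (Re (z / of_nat j) + (norm (z / of_nat j))\<^sup>2 / 2)"
    by (rule norm_one_plus_le_exp)
  also have "\<dots> \<le> exp (Re z / of_nat j + (R\<^sup>2 / 2) / (of_nat j)\<^sup>2)"
    using power_mono[OF assms norm_ge_zero, of 2]
    by (auto simp: norm_divide power_divide divide_simps)
  finally show "norm (1 + z / of_nat j) \<le> exp (Re z / of_nat j + (R\<^sup>2 / 2) / (of_nat j)\<^sup>2)" .
qed auto

lemma inverse_norm_prod_one_plus_le:
  fixes z :: complex
  assumes "norm z \<le> R" "0 < d" "\<And>j. 0 < j \<Longrightarrow> d \<le> norm (1 + z / of_nat j)"
  shows "inverse (norm (\<Prod>j=1..m. 1 + z / of_nat j)) \<le>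
           exp (- Re z * harm m + (3 + 4 / d) * R\<^sup>2 * (pi\<^sup>2 / 6))"
  unfolding prod_norm[symmetric] prod_inversef[symmetric] o_def
proof (rule prod_le_exp_harm)
  fix j assume "j \<in> {1..m}"
  then have "inverse (norm (1 + z / of_nat j)) \<le>
      exp (- Re (z / of_nat j) + (3 + 4 / d) * (norm (z / of_nat j))\<^sup>2)"
    using assms by (intro inverse_norm_one_plus_le_exp) auto
  also have "\<dots> \<le> exp (- Re z / of_nat j + ((3 + 4 / d) * R\<^sup>2) / (of_nat j)\<^sup>2)"
    using power_mono[OF assms(1) norm_ge_zero, of 2] assms(2)
    by (auto simp: norm_divide power_divide intro!: divide_right_mono mult_left_mono)
  finally show "inverse (norm (1 + z / of_nat j)) \<le>
      exp (- Re z / of_nat j + ((3 + 4 / d) * R\<^sup>2) / (of_nat j)\<^sup>2)" .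
qed (use assms in auto)

text \<open>
  The factors \<open>1 + z / j\<close> do not vanish and tend to \<open>1\<close>, so their inverses form a bounded sequence.
\<close>

lemma norm_one_plus_over_nat_bounded_below:
  fixes z :: complex
  assumes "\<And>j. 0 < j \<Longrightarrow> z + of_nat j \<noteq> 0"
  obtains d where "0 < d" "\<And>j. 0 < j \<Longrightarrow> d \<le> norm (1 + z / of_nat j)"
proof -
  have "(\<lambda>j. inverse (1 + z / of_nat j)) \<longlonglongrightarrow> inverse (1 + 0)"
    by (intro tendsto_intros tendsto_divide_0[OF tendsto_const] tendsto_of_nat) auto
  then have "Bseq (\<lambda>j. inverse (1 + z / of_nat j))"
    by (intro convergent_imp_Bseq convergentI)
  then obtain B where B: "0 < B" "\<And>j. norm (inverse (1 + z / of_nat j)) \<le> B"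
    unfolding Bseq_def by blast
  show ?thesis
  proof
    show "0 < 1 / B" using B by simp
    fix j :: nat assume j: "0 < j"
    have "1 + z / of_nat j = (z + of_nat j) / of_nat j" using j by (simp add: field_simps)
    then have "1 + z / of_nat j \<noteq> 0" using assms[OF j] j by simp
    then show "1 / B \<le> norm (1 + z / of_nat j)"
      using B(1) B(2)[of j] by (simp add: norm_inverse inverse_eq_divide del: norm_divide)
        (simp add: norm_divide field_simps)
  qed
qed

section \<open>Domination and passage to the limit\<close>

lemma pochhammer_Suc_eq_fact_prod:
  "pochhammer z (Suc m) = z * fact m * (\<Prod>j=1..m. 1 + z / of_nat j)"
  for z :: "'a::field_char_0"
proof (induction m)
  case (Suc m)
  have "pochhammer z (Suc (Suc m)) = pochhammer z (Suc m) * (z + of_nat (Suc m))"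
    by (simp add: pochhammer_Suc)
  also have "z + of_nat (Suc m) = of_nat (Suc m) * (1 + z / of_nat (Suc m))"
    by (simp add: distrib_left del: of_nat_Suc)
  finally show ?case
    unfolding Suc.IH by (simp add: mult_ac del: of_nat_Suc)
qed simp

text \<open>
  The factors \<open>v - k, \<dots>, v - 1\<close> in reverse order. In the numerator of a term of the
  expansion these are the factors shifted by \<open>k\<close>, and they supply its decay once they are
  divided by \<open>fact k\<close>.
\<close>

lemma pochhammer_diff_of_nat_eq_fact_prod:
  "pochhammer (v - of_nat k) k = (-1) ^ k * fact k * (\<Prod>j=1..k. 1 - v / of_nat j)"
  for v :: "'a::field_char_0"
proof -
  have "pochhammer (1 - v) m = fact m * (\<Prod>j=1..m. 1 - v / of_nat j)" for m
  proof (induction m)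
    case (Suc m)
    have "1 - v + of_nat m = of_nat (Suc m) * (1 - v / of_nat (Suc m))"
      by (simp add: right_diff_distrib del: of_nat_Suc) simp
    then show ?case
      unfolding pochhammer_Suc Suc.IH by (simp add: mult_ac del: of_nat_Suc)
  qed simp
  then show ?thesis
    using pochhammer_minus[of "of_nat k - v" k] by (simp add: algebra_simps)
qed

lemma abs_ln_minus_harm_bounded:
  obtains C where "\<And>n::nat. \<bar>harm n - ln (real n)\<bar> \<le> C"
proof -
  from euler_mascheroni_convergent have "Bseq (\<lambda>n. harm n - ln (real n))"
    by (rule convergent_imp_Bseq)
  then obtain C where "\<And>n. norm (harm n - ln (real n)) \<le> C"
    unfolding Bseq_def by blast
  then show ?thesis by (intro that[of C]) simp
qed

lemma choose_over_power_tendsto: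
  "(\<lambda>n. of_nat (n choose k) / of_nat n ^ k) \<longlonglongrightarrow> (1 / fact k :: 'a::{real_normed_field})"
proof -
  have "(\<lambda>n. (\<Prod>i<k. 1 - of_nat i / of_nat n :: 'a) / fact k) \<longlonglongrightarrow> (\<Prod>i<k. 1 - 0) / fact k"
    by (intro tendsto_intros tendsto_divide_0[OF tendsto_const] tendsto_of_nat) auto
  moreover have "\<forall>\<^sub>F n in sequentially. (\<Prod>i<k. 1 - of_nat i / of_nat n :: 'a) / fact k
      = of_nat (n choose k) / of_nat n ^ k"
    using eventually_gt_at_top[of 0]
  proof eventually_elim
    case (elim n)
    have "of_nat (n choose k) = (\<Prod>i<k. of_nat n - of_nat i :: 'a) / fact k"
      by (simp add: binomial_gbinomial gbinomial_prod_rev lessThan_atLeast0)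
    also have "(\<Prod>i<k. of_nat n - of_nat i :: 'a) = (\<Prod>i<k. of_nat n * (1 - of_nat i / of_nat n))"
      using elim by (intro prod.cong) (auto simp: field_simps)
    also have "\<dots> = of_nat n ^ k * (\<Prod>i<k. 1 - of_nat i / of_nat n)"
      by (simp add: prod.distrib)
    finally show ?case using elim by (simp add: field_simps)
  qed
  ultimately show ?thesis by (auto elim: Lim_transform_eventually)
qed

text \<open>
  Splitting the Pochhammer symbol of \<open>v + a - k\<close> after \<open>k\<close> factors cancels all factorials and
  leaves the products \<open>P\<^sub>1\<close>, \<open>P\<^sub>2\<close>, \<open>P\<^sub>3\<close>. By the exponential bounds, and because
  \<open>ln n\<close> differs from \<open>harm n\<close> by a bounded amount, the harmonic numbers enter the exponent as
  \<open>- Re (v + a) (harm n - harm (n - k)) - Re (v + a) harm k\<close>. The first summand is nonpositive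
  and can be dropped, which is what makes the bound independent of \<open>n\<close>. All constants depend on
  \<open>v\<close> only through bounds that hold uniformly near a point outside the non-positive integers.
\<close>

lemma norm_choose_Gamma_series_rGamma_series_le:
  fixes a v :: complex
  assumes R: "norm v \<le> R" "norm (v + a) \<le> R"
    and e: "0 < e" "e \<le> norm v"
    and d: "0 < d" "\<And>j. 0 < j \<Longrightarrow> d \<le> norm (1 + v / of_nat j)"
    and \<delta>: "0 \<le> \<delta>" "\<delta> \<le> Re (v + a)"
    and C: "\<And>m::nat. \<bar>harm m - ln (real m)\<bar> \<le> C"
    and kn: "k \<le> n" "0 < n"
  shows "norm (of_nat (n choose k) / of_nat n ^ k *
           (Gamma_series v n * rGamma_series (v + a - of_nat k) n))
         \<le> (R / e) * exp (\<bar>Re a\<bar> * C + (4 + 4 / d) * R\<^sup>2 * (pi\<^sup>2 / 6)) * exp (- \<delta> * harm k)"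
proof -
  define P\<^sub>1 where "P\<^sub>1 = (\<Prod>j=1..k. 1 - (v + a) / of_nat j)"
  define P\<^sub>2 where "P\<^sub>2 = (\<Prod>j=1..n-k. 1 + (v + a) / of_nat j)"
  define P\<^sub>3 where "P\<^sub>3 = (\<Prod>j=1..n. 1 + v / of_nat j)"
  define B where "B = R\<^sup>2 * (pi\<^sup>2 / 6)"
  define L where "L = complex_of_real (ln (of_nat n))"
  have num: "pochhammer (v + a - of_nat k) (Suc n) =
      ((-1) ^ k * fact k * P\<^sub>1) * ((v + a) * fact (n - k) * P\<^sub>2)"
    using kn pochhammer_product[of k "Suc n" "v + a - of_nat k"]
    by (simp add: Suc_diff_le pochhammer_diff_of_nat_eq_fact_prod pochhammer_Suc_eq_fact_prod P\<^sub>1_def P\<^sub>2_def)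
  have den: "pochhammer v (Suc n) = v * fact n * P\<^sub>3"
    by (simp add: pochhammer_Suc_eq_fact_prod P\<^sub>3_def)
  have pow: "exp ((v - (v + a - of_nat k)) * L) = of_nat n ^ k * exp (- a * L)"
  proof -
    have "exp (of_nat k * L) = of_nat n ^ k"
      using kn by (simp add: L_def exp_of_nat_mult exp_of_real)
    moreover have "(v - (v + a - of_nat k)) * L = of_nat k * L + - a * L"
      by (simp add: algebra_simps)
    ultimately show ?thesis by (simp only: exp_add)
  qed
  have "of_nat (n choose k) / of_nat n ^ k *
      (Gamma_series v n * rGamma_series (v + a - of_nat k) n) =
      (-1) ^ k * exp (- a * L) * P\<^sub>1 * (v + a) * P\<^sub>2 / (v * P\<^sub>3)"
    unfolding Gamma_series_mult_rGamma_series num den L_def[symmetric] pow binomial_fact[OF kn(1)]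
    using kn by simp
  then have eq: "norm (of_nat (n choose k) / of_nat n ^ k *
      (Gamma_series v n * rGamma_series (v + a - of_nat k) n)) =
      exp (- Re a * ln n) * norm P\<^sub>1 * norm P\<^sub>2 * inverse (norm P\<^sub>3) * (norm (v + a) / norm v)"
    by (simp add: norm_mult norm_divide norm_power norm_inverse L_def divide_inverse mult_ac)
  have "norm (v + a) / norm v \<le> R / e"
    using R e by (intro frac_le) (auto intro: order_trans[OF norm_ge_zero])
  moreover have "exp (- Re a * ln n) \<le> exp (- Re a * harm n + \<bar>Re a\<bar> * C)"
  proof -
    have "Re a * (harm n - ln n) \<le> \<bar>Re a\<bar> * C"
      using C[of n] by (metis abs_ge_self abs_mult mult_left_mono abs_ge_zero order_trans)
    then show ?thesis by (simp add: algebra_simps)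
  qed
  moreover have "norm P\<^sub>1 \<le> exp (- Re (v + a) * harm k + B / 2)"
  proof -
    have "P\<^sub>1 = (\<Prod>j=1..k. 1 + - (v + a) / of_nat j)"
      unfolding P\<^sub>1_def by (simp only: diff_conv_add_uminus minus_divide_left)
    moreover have "norm (- (v + a)) \<le> R" using R(2) by (simp only: norm_minus_cancel)
    ultimately show ?thesis
      using norm_prod_one_plus_le[of "- (v + a)" R k] by (simp only: B_def) simp
  qed
  moreover have "norm P\<^sub>2 \<le> exp (Re (v + a) * harm (n - k) + B / 2)"
    using norm_prod_one_plus_le[OF R(2), of "n - k"] by (simp add: P\<^sub>2_def B_def)
  moreover have "inverse (norm P\<^sub>3) \<le> exp (- Re v * harm n + (3 + 4 / d) * B)"
    using inverse_norm_prod_one_plus_le[OF R(1) d, of n] by (simp add: P\<^sub>3_def B_def mult.assoc)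
  ultimately have "exp (- Re a * ln n) * norm P\<^sub>1 * norm P\<^sub>2 * inverse (norm P\<^sub>3) * (norm (v + a) / norm v)
      \<le> exp (- Re a * harm n + \<bar>Re a\<bar> * C) * exp (- Re (v + a) * harm k + B / 2) *
        exp (Re (v + a) * harm (n - k) + B / 2) * exp (- Re v * harm n + (3 + 4 / d) * B) * (R / e)"
    by (intro mult_mono) auto
  also have "\<dots> = exp (\<bar>Re a\<bar> * C + (4 + 4 / d) * B - Re (v + a) * (harm n - harm (n - k))
        - Re (v + a) * harm k) * (R / e)"
    by (simp flip: exp_add) (simp add: algebra_simps)
  also have "\<dots> \<le> exp (\<bar>Re a\<bar> * C + (4 + 4 / d) * B - \<delta> * harm k) * (R / e)"
  proof (intro mult_right_mono exp_le_cancel_iff[THEN iffD2])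
    have "0 \<le> Re (v + a) * (harm n - harm (n - k))"
      using \<delta> harm_mono[of "n - k" n, where ?'a = real] by (intro mult_nonneg_nonneg) auto
    moreover have "\<delta> * harm k \<le> Re (v + a) * harm k"
      using \<delta> by (intro mult_right_mono harm_nonneg)
    ultimately show "\<bar>Re a\<bar> * C + (4 + 4 / d) * B - Re (v + a) * (harm n - harm (n - k)) - Re (v + a) * harm k
        \<le> \<bar>Re a\<bar> * C + (4 + 4 / d) * B - \<delta> * harm k" by linarith
    show "0 \<le> R / e" using R e norm_ge_zero[of v] by simp
  qed
  also have "\<dots> = (R / e) * exp (\<bar>Re a\<bar> * C + (4 + 4 / d) * B) * exp (- \<delta> * harm k)"
    by (simp add: exp_diff exp_minus divide_inverse)
  finally show ?thesis unfolding eq B_def by (simp add: mult.assoc)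
qed

lemma norm_inverse_plus_of_nat_le:
  fixes x :: complex
  shows "\<forall>\<^sub>F k in sequentially. norm (1 / (x + of_nat k)) \<le> 2 / real k"
  using eventually_ge_at_top[of "nat \<lceil>2 * norm x\<rceil> + 1"]
proof eventually_elim
  case (elim k)
  then have k: "2 * norm x \<le> real k" "0 < real k" by linarith+
  have "real k - norm x \<le> norm (x + of_nat k)"
    using norm_triangle_ineq4[of "x + of_nat k" x] by simp
  then have "real k / 2 \<le> norm (x + of_nat k)" using k by linarith
  then have "1 / norm (x + of_nat k) \<le> 1 / (real k / 2)" using k by (intro frac_le) auto
  then show ?case by (simp add: norm_divide)
qed

theorem corollary3p1:
  fixes x\<^sub>1 x\<^sub>2 a l :: complex
  assumes "Re (a + l) > 0"
    and "x\<^sub>1 \<notin> \<int>\<^sub>\<le>\<^sub>0" and "x\<^sub>2 \<notin> \<int>\<^sub>\<le>\<^sub>0" and "l \<notin> \<int>\<^sub>\<le>\<^sub>0"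
    and "\<And>k::nat. l - (l - x\<^sub>1) * (l - x\<^sub>2) / (l + of_nat k) \<notin> \<int>\<^sub>\<le>\<^sub>0"
  shows "(\<lambda>k::nat. (- 1) ^ k / fact k *
            (Gamma (l - (l - x\<^sub>1) * (l - x\<^sub>2) / (l + of_nat k)) *
             rGamma (l - (l - x\<^sub>1) * (l - x\<^sub>2) / (l + of_nat k) + a - of_nat k)) *
            (1 / (x\<^sub>1 + of_nat k) + 1 / (x\<^sub>2 + of_nat k) - 1 / (l + of_nat k)))
         sums (Gamma x\<^sub>1 * Gamma x\<^sub>2 * rGamma (x\<^sub>1 + x\<^sub>2 + a))"
proof -
  define w where "w = (\<lambda>k::nat. l - (l - x\<^sub>1) * (l - x\<^sub>2) / (l + of_nat k))"
  define weight where
    "weight k = 1 / (x\<^sub>1 + of_nat k) + 1 / (x\<^sub>2 + of_nat k) - 1 / (l + of_nat k)" for k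
  \<comment> \<open>\<open>T k n\<close> is the term of the truncated identity and \<open>U k\<close> the term of the series.\<close>
  define T where "T k n = (-1) ^ k * (of_nat (n choose k) / of_nat n ^ k) *
      (Gamma_series (w k) n * rGamma_series (w k + a - of_nat k) n) * weight k" for k n
  define U where "U k = (-1) ^ k / fact k * (Gamma (w k) * rGamma (w k + a - of_nat k)) * weight k" for k
  define \<delta> where "\<delta> = Re (a + l) / 2"
  have \<delta>: "0 < \<delta>" using assms(1) by (simp add: \<delta>_def)
  have nz: "z + of_nat j \<noteq> 0" if "z \<notin> \<int>\<^sub>\<le>\<^sub>0" for z :: complex and j
    using that by (metis plus_of_nat_eq_0_imp)
  note nzs = nz[OF assms(2)] nz[OF assms(3)] nz[OF assms(4)] nz[OF assms(5)]

  have T_lim: "T k \<longlonglongrightarrow> U k" for k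
  proof -
    have "(\<lambda>n. T k n) \<longlonglongrightarrow>
        (-1) ^ k * (1 / fact k) * (Gamma (w k) * rGamma (w k + a - of_nat k)) * weight k"
      unfolding T_def
      by (intro tendsto_intros choose_over_power_tendsto Gamma_series_LIMSEQ)
    then show ?thesis by (simp add: U_def)
  qed

  have w_lim: "w \<longlonglongrightarrow> l"
  proof -
    have "w \<longlonglongrightarrow> l - 0"
      unfolding w_def
      by (intro tendsto_intros tendsto_divide_0[OF tendsto_const]
          tendsto_add_filterlim_at_infinity[OF tendsto_const] tendsto_of_nat)
    then show ?thesis by simp
  qed
  obtain d where d: "0 < d" "\<And>j. 0 < j \<Longrightarrow> d \<le> norm (1 + l / of_nat j)"
    using norm_one_plus_over_nat_bounded_below[of l] nz[OF assms(4)] by blast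
  obtain C where C: "\<And>m::nat. \<bar>harm m - ln (real m)\<bar> \<le> C"
    using abs_ln_minus_harm_bounded by blast
  define R where "R = norm l + norm a + 1"
  have l0: "l \<noteq> 0" using nz[OF assms(4), of 0] by simp
  define K where "K = (R / (norm l / 2)) *
      exp (\<bar>Re a\<bar> * C + (4 + 4 / (d / 2)) * R\<^sup>2 * (pi\<^sup>2 / 6))"
  have K: "0 \<le> K" by (simp add: K_def R_def)
  \<comment> \<open>The terms contribute order \<open>- \<delta>\<close> in \<open>k\<close>, and the three fractions in the weight another \<open>- 1\<close>.\<close>
  define M where "M k = 6 * K * real k powr (- 1 - \<delta>)" for k :: nat

  \<comment> \<open>As \<open>w k\<close> tends to \<open>l\<close>, all bounds valid at \<open>l\<close> hold at \<open>w k\<close> with half the margin once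
     \<open>k\<close> is large; this is the reason for the halves in \<open>\<delta>\<close> and in \<open>K\<close>.\<close>
  have "\<forall>\<^sub>F k in sequentially. dist (w k) l < min (min 1 (norm l / 2)) (min (d / 2) \<delta>)"
    using d(1) \<delta> l0 by (intro tendstoD[OF w_lim]) auto
  then have "\<forall>\<^sub>F k in sequentially. \<forall>n>0. norm (T k n) \<le> M k"
    using norm_inverse_plus_of_nat_le[of x\<^sub>1] norm_inverse_plus_of_nat_le[of x\<^sub>2]
      norm_inverse_plus_of_nat_le[of l] eventually_gt_at_top[of 0]
  proof eventually_elim
    case (elim k)
    have close: "norm (w k - l) < 1" "norm (w k - l) < norm l / 2" "norm (w k - l) < d / 2"
        "norm (w k - l) < \<delta>"
      using elim(1) d \<delta> l0 by (auto simp: dist_norm)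
    show ?case
    proof (intro allI impI)
      fix n :: nat assume n: "0 < n"
      show "norm (T k n) \<le> M k"
      proof (cases "k \<le> n")
        case True
        have "norm (w k) \<le> norm l + 1"
          using norm_triangle_ineq[of "w k - l" l] close by simp
        then have R: "norm (w k) \<le> R" "norm (w k + a) \<le> R"
          using norm_triangle_ineq[of "w k" a] norm_ge_zero[of a] unfolding R_def by linarith+
        have e: "norm l / 2 \<le> norm (w k)"
          using norm_triangle_ineq2[of l "l - w k"] close by (simp add: norm_minus_commute)
        have d': "d / 2 \<le> norm (1 + w k / of_nat j)" if "0 < j" for j
        proof -
          have "norm (1 + l / of_nat j - (1 + w k / of_nat j)) = norm (w k - l) / real j"
            by (simp add: norm_divide norm_minus_commute flip: diff_divide_distrib)
          also have "\<dots> \<le> norm (w k - l)"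
            using that by (simp add: divide_le_eq mult_le_cancel_left1)
          finally show ?thesis
            using norm_triangle_ineq2[of "1 + l / of_nat j" "1 + l / of_nat j - (1 + w k / of_nat j)"]
              d(2)[OF that] close by simp
        qed
        have \<delta>': "\<delta> \<le> Re (w k + a)"
          using abs_Re_le_cmod[of "w k - l"] close unfolding \<delta>_def by simp
        have "norm (of_nat (n choose k) / of_nat n ^ k *
           (Gamma_series (w k) n * rGamma_series (w k + a - of_nat k) n)) \<le> K * exp (- \<delta> * harm k)"
          unfolding K_def using l0 d \<delta>
          by (intro norm_choose_Gamma_series_rGamma_series_le R e d' \<delta>' C True n) auto
        also have "\<dots> \<le> K * real k powr (- \<delta>)"
        proof -
          have "ln (real k) \<le> harm k"
            using elim harm_ge_ln[of k] ln_mono[of "real k" "real k + 1"] by linarith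
          then have "exp (- \<delta> * harm k) \<le> real k powr (- \<delta>)"
            using elim \<delta> by (simp add: powr_def)
          then show ?thesis using K by (rule mult_left_mono)
        qed
        finally have main: "norm (of_nat (n choose k) / of_nat n ^ k *
           (Gamma_series (w k) n * rGamma_series (w k + a - of_nat k) n)) \<le> K * real k powr (- \<delta>)" .
        have "norm (weight k) \<le> 6 / real k"
          unfolding weight_def
          using norm_triangle_ineq4[of "1 / (x\<^sub>1 + of_nat k) + 1 / (x\<^sub>2 + of_nat k)" "1 / (l + of_nat k)"]
            norm_triangle_ineq[of "1 / (x\<^sub>1 + of_nat k)" "1 / (x\<^sub>2 + of_nat k)"] elim(2-4)
          by linarith
        with main have "norm (of_nat (n choose k) / of_nat n ^ k *
           (Gamma_series (w k) n * rGamma_series (w k + a - of_nat k) n)) * norm (weight k)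
           \<le> K * real k powr (- \<delta>) * (6 / real k)"
          using K by (intro mult_mono) auto
        also have "\<dots> = M k"
          using elim by (simp add: M_def powr_diff powr_minus field_simps)
        also have "norm (of_nat (n choose k) / of_nat n ^ k *
           (Gamma_series (w k) n * rGamma_series (w k + a - of_nat k) n)) * norm (weight k) = norm (T k n)"
          by (simp add: T_def norm_mult norm_divide norm_power)
        finally show ?thesis .
      next
        case False
        then have "T k n = 0" by (simp add: T_def binomial_eq_0)
        then show ?thesis using K by (simp add: M_def)
      qed
    qed
  qed
  then have "\<forall>\<^sub>F (k, n) in sequentially \<times>\<^sub>F sequentially. norm (T k n) \<le> M k"
    using eventually_prodI[OF _ eventually_gt_at_top[of 0]]
    by (fastforce elim: eventually_mono)
  moreover have "summable M"
    unfolding M_def using \<delta> by (intro summable_mult) (simp add: summable_real_powr_iff)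
  ultimately have tannery: "summable (\<lambda>k. norm (U k))" "(\<lambda>n. \<Sum>k. T k n) \<longlonglongrightarrow> (\<Sum>k. U k)"
    using tannerys_theorem[of T U sequentially M] T_lim by auto

  have "(\<lambda>n. exp (- (a + l) * of_real (ln (of_nat n)))) \<longlonglongrightarrow> 0"
  proof (rule tendsto_norm_zero_cancel)
    have "(\<lambda>n. real n powr (- Re (a + l))) \<longlonglongrightarrow> 0"
      using assms(1)
      by (intro tendsto_neg_powr filterlim_real_sequentially) (simp only: neg_less_0_iff_less)
    then show "(\<lambda>n. norm (exp (- (a + l) * of_real (ln (of_nat n))))) \<longlonglongrightarrow> 0"
      by (rule Lim_transform_eventually)
        (use eventually_gt_at_top[of 0] in eventually_elim, simp add: powr_def)
  qed
  then have "(\<lambda>n. Gamma_series l n * exp (- (a + l) * of_real (ln (of_nat n))) + (\<Sum>k. T k n))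
      \<longlonglongrightarrow> Gamma l * 0 + (\<Sum>k. U k)"
    by (intro tendsto_intros Gamma_series_LIMSEQ tannery)
  moreover have "\<forall>\<^sub>F n in sequentially.
      Gamma_series l n * exp (- (a + l) * of_real (ln (of_nat n))) + (\<Sum>k. T k n) =
      Gamma_series x\<^sub>1 n * Gamma_series x\<^sub>2 n * rGamma_series (x\<^sub>1 + x\<^sub>2 + a) n"
    using eventually_gt_at_top[of 0]
  proof eventually_elim
    case (elim n)
    have "(\<Sum>k. T k n) = (\<Sum>k\<le>n. T k n)"
      by (rule suminf_finite) (auto simp: T_def)
    then show ?case
      using Gamma_series_beta_expansion[of x\<^sub>1 x\<^sub>2 l n a] nzs elim
      by (simp add: T_def w_def weight_def)
  qed
  ultimately have "(\<lambda>n. Gamma_series x\<^sub>1 n * Gamma_series x\<^sub>2 n * rGamma_series (x\<^sub>1 + x\<^sub>2 + a) n)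
      \<longlonglongrightarrow> (\<Sum>k. U k)"
    by (auto elim: Lim_transform_eventually)
  moreover have "(\<lambda>n. Gamma_series x\<^sub>1 n * Gamma_series x\<^sub>2 n * rGamma_series (x\<^sub>1 + x\<^sub>2 + a) n)
      \<longlonglongrightarrow> Gamma x\<^sub>1 * Gamma x\<^sub>2 * rGamma (x\<^sub>1 + x\<^sub>2 + a)"
    by (intro tendsto_intros Gamma_series_LIMSEQ)
  ultimately have "(\<Sum>k. U k) = Gamma x\<^sub>1 * Gamma x\<^sub>2 * rGamma (x\<^sub>1 + x\<^sub>2 + a)"
    by (rule LIMSEQ_unique)
  then have "U sums (Gamma x\<^sub>1 * Gamma x\<^sub>2 * rGamma (x\<^sub>1 + x\<^sub>2 + a))"
    using summable_norm_cancel[OF tannery(1)] by (simp add: sums_iff)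
  then show ?thesis
    by (simp only: U_def[abs_def] w_def weight_def)
qed

end
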